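(* Let $\mathcal{T}$ be a triangulation of a planar polygonal domain such that all the angles (at vertices, of triangles of $\mathcal{T}$) are different from $\pi/2$. Then for each triangle $f$ of $\mathcal{T}$, the space $\mathrm{P}_1(f)\otimes\mathbb{S}_2$ is unisolvent with respect to the degrees of freedom - $\mathrm{tr}\,\sigma(x)$ at each vertex $x$ of $f$; - $\int_e(\tau_e^T\sigma\tau_e)\,p$ for $p\in\mathrm{P}_1(e)$, for each edge $e$ of $f$ with unit tangent $\tau_e$ (two moments per edge).
   Context: $\mathrm{P}_1(s)$: polynomials of degree at most $1$ on a simplex $s$. $\mathbb{S}_2$: real symmetric $2\times2$ matrices. Unisolvent means: the listed linear forms (with $p$ ranging over a basis of $\mathrm{P}_1(e)$) form a basis of the dual of $\mathrm{P}_1(f)\otimes\mathbb{S}_2$. *)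

theory Defs
  imports "HOL-Analysis.Analysis" "HOL-Library.Function_Algebras"
begin

text \<open>
  Pointwise scalar multiplication makes function types real vector spaces, so that the
  library's \<open>span\<close> and \<open>independent\<close> apply both to spaces of fields and to spaces of
  linear forms on them.
\<close>

instantiation "fun" :: (type, scaleR) scaleR
begin

definition scaleR_fun :: "real \<Rightarrow> ('a \<Rightarrow> 'b) \<Rightarrow> 'a \<Rightarrow> 'b"
  where "scaleR_fun c f = (\<lambda>x. c *\<^sub>R f x)"

instance ..

end

instance "fun" :: (type, real_vector) real_vector
  by standard (auto simp: scaleR_fun_def fun_eq_iff scaleR_add_right scaleR_add_left)

text \<open>
  The linear forms on a subspace \<open>V\<close>; a form is extended by \<open>0\<close> outside \<open>V\<close>, so that
  distinct elements of the set are distinct linear forms on \<open>V\<close>.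
\<close>

definition dual_space :: "'v::real_vector set \<Rightarrow> ('v \<Rightarrow> real) set"
  where "dual_space V = {\<phi>. (\<forall>u\<in>V. \<forall>v\<in>V. \<phi> (u + v) = \<phi> u + \<phi> v) \<and>
                            (\<forall>c. \<forall>u\<in>V. \<phi> (c *\<^sub>R u) = c * \<phi> u) \<and>
                            (\<forall>u. u \<notin> V \<longrightarrow> \<phi> u = 0)}"

definition restrict_form :: "'v::real_vector set \<Rightarrow> ('v \<Rightarrow> real) \<Rightarrow> 'v \<Rightarrow> real"
  where "restrict_form V \<phi> = (\<lambda>v. if v \<in> V then \<phi> v else 0)"

definition basis_of :: "'v::real_vector set \<Rightarrow> 'v set \<Rightarrow> bool"
  where "basis_of W B \<longleftrightarrow> independent B \<and> span B = W"

definition unisolvent :: "'v::real_vector set \<Rightarrow> 'i set \<Rightarrow> ('i \<Rightarrow> 'v \<Rightarrow> real) \<Rightarrow> bool"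
  where "unisolvent V I L \<longleftrightarrow>
    inj_on (\<lambda>i. restrict_form V (L i)) I \<and>
    basis_of (dual_space V) ((\<lambda>i. restrict_form V (L i)) ` I)"

text \<open>
  A function on a set \<open>s\<close> is represented by its extension by \<open>0\<close> to the whole plane; on an
  edge, affine functions of the plane with the same restriction are thereby identified.
\<close>

definition P1 :: "(real^2) set \<Rightarrow> (real^2 \<Rightarrow> real) set"
  where "P1 s = {p. \<exists>a b. p = (\<lambda>x. if x \<in> s then a + b \<bullet> x else 0)}"

definition S2 :: "(real^2^2) set"
  where "S2 = {A. transpose A = A}"

text \<open>The pure tensor of \<open>p\<close> and \<open>A\<close> is identified with the matrix field \<open>x \<mapsto> p(x) A\<close>.\<close>

definition P1_S2 :: "(real^2) set \<Rightarrow> (real^2 \<Rightarrow> real^2^2) set"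
  where "P1_S2 f = span {(\<lambda>x. p x *\<^sub>R A) | p A. p \<in> P1 f \<and> A \<in> S2}"

definition polygonal_domain :: "(real^2) set \<Rightarrow> bool"
  where "polygonal_domain \<Omega> \<longleftrightarrow> open \<Omega> \<and> connected \<Omega> \<and> bounded \<Omega> \<and> \<Omega> \<noteq> {} \<and>
    (\<exists>S. finite S \<and> frontier \<Omega> = (\<Union>(a, b)\<in>S. closed_segment a b))"

text \<open>
  The members of \<open>\<T>\<close> may be the triangles only, or also their edges and vertices.
\<close>

definition triangulation_of :: "(real^2) set set \<Rightarrow> (real^2) set \<Rightarrow> bool"
  where "triangulation_of \<T> \<Omega> \<longleftrightarrow> triangulation \<T> \<and> \<Union>\<T> = closure \<Omega>"

definition triangles :: "(real^2) set set \<Rightarrow> (real^2) set set"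
  where "triangles \<T> = {f \<in> \<T>. 2 simplex f}"

definition vertices :: "(real^2) set \<Rightarrow> (real^2) set"
  where "vertices f = {x. x extreme_point_of f}"

definition edges :: "(real^2) set \<Rightarrow> (real^2) set set"
  where "edges f = {e. e edge_of f}"

text \<open>The unoriented angle at \<open>b\<close>, between the directions to \<open>a\<close> and to \<open>c\<close>.\<close>

definition angle_at :: "real^2 \<Rightarrow> real^2 \<Rightarrow> real^2 \<Rightarrow> real"
  where "angle_at a b c = arccos (((a - b) \<bullet> (c - b)) / (norm (a - b) * norm (c - b)))"

definition no_right_angle :: "(real^2) set set \<Rightarrow> bool"
  where "no_right_angle \<T> \<longleftrightarrow>
    (\<forall>f\<in>triangles \<T>. \<forall>a\<in>vertices f. \<forall>b\<in>vertices f. \<forall>c\<in>vertices f.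
       a \<noteq> b \<longrightarrow> b \<noteq> c \<longrightarrow> a \<noteq> c \<longrightarrow> angle_at a b c \<noteq> pi / 2)"

definition unit_tangent :: "(real^2) set \<Rightarrow> real^2 \<Rightarrow> bool"
  where "unit_tangent e \<tau> \<longleftrightarrow>
    (\<exists>a b. a \<noteq> b \<and> e = closed_segment a b \<and> \<tau> = (1 / norm (b - a)) *\<^sub>R (b - a))"

text \<open>
  The integral over a segment with respect to arc length. It does not depend on which
  endpoint is taken first, as shown below.
\<close>

definition edge_integral :: "(real^2) set \<Rightarrow> (real^2 \<Rightarrow> real) \<Rightarrow> real"
  where "edge_integral e g =
    (let (a, b) = (SOME (a, b). e = closed_segment a b)
     in dist a b * integral {0..1} (\<lambda>t. g (linepath a b t)))"

lemma edge_integral_closed_segment: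
  "edge_integral (closed_segment a b) g = dist a b * integral {0..1} (\<lambda>t. g (linepath a b t))"
proof -
  define q where "q = (SOME (c, d). closed_segment a b = closed_segment c d)"
  obtain c d where q: "q = (c, d)"
    by fastforce
  have "case q of (c, d) \<Rightarrow> closed_segment a b = closed_segment c d"
    unfolding q_def by (rule someI[where x = "(a, b)"]) simp
  then have "{a, b} = {c, d}"
    by (simp add: q)
  then consider "c = a" "d = b" | "c = b" "d = a"
    by (auto simp: doubleton_eq_iff)
  then have "dist c d * integral {0..1} (\<lambda>t. g (linepath c d t)) =
             dist a b * integral {0..1} (\<lambda>t. g (linepath a b t))"
  proof cases
    case 2
    have "integral {0..1} (\<lambda>t. g (linepath b a t)) =
          integral {- 1..- 0} (\<lambda>t. g (linepath b a (- t)))"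
      by (rule Henstock_Kurzweil_Integration.integral_reflect_real[symmetric])
    also have "(\<lambda>t. g (linepath b a (- t))) = (\<lambda>t. g (linepath a b t)) \<circ> (+) 1"
      by (simp add: fun_eq_iff linepath_def add.commute)
    also have "integral {- 1..- 0} \<dots> = integral {0..1} (\<lambda>t. g (linepath a b t))"
      by (subst integral_shift_Icc_real) simp
    finally show ?thesis
      using 2 by (simp add: dist_commute)
  qed simp
  then show ?thesis
    unfolding edge_integral_def q_def[symmetric] by (simp add: q)
qed

text \<open>
  The degrees of freedom are indexed by a vertex, or by an edge \<open>e\<close> together with a
  member of a basis \<open>B e\<close> of \<open>P1 e\<close>.
\<close>

type_synonym dof_index = "(real^2) + (real^2) set \<times> (real^2 \<Rightarrow> real)"

definition dof_indices ::
  "((real^2) set \<Rightarrow> (real^2 \<Rightarrow> real) set) \<Rightarrow> (real^2) set \<Rightarrow> dof_index set"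
  where "dof_indices B f = Inl ` vertices f \<union> Inr ` (SIGMA e:edges f. B e)"

fun dof :: "((real^2) set \<Rightarrow> real^2) \<Rightarrow> dof_index \<Rightarrow> (real^2 \<Rightarrow> real^2^2) \<Rightarrow> real"
  where
    "dof \<tau> (Inl x) \<sigma> = trace (\<sigma> x)"
  | "dof \<tau> (Inr (e, p)) \<sigma> = edge_integral e (\<lambda>x. (\<tau> e \<bullet> (\<sigma> x *v \<tau> e)) * p x)"

end

theory Submission
  imports Defs
begin

text \<open>
  Suppose that all degrees of freedom of \<open>\<sigma>\<close> vanish. On an edge \<open>e\<close> the function
  \<open>\<tau>\<^sub>e\<^sup>T \<sigma> \<tau>\<^sub>e\<close> is affine and orthogonal to \<open>P1 e\<close>, hence zero. At a vertex with adjacent edge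
  directions \<open>u\<close> and \<open>w\<close>, the matrix \<open>\<sigma>(x)\<close> is therefore symmetric and traceless with
  \<open>u\<^sup>T \<sigma>(x) u = w\<^sup>T \<sigma>(x) w = 0\<close>; this is a \<open>2 \<times> 2\<close> linear system whose determinant is
  \<open>2 (u \<bullet> w) det(u, w)\<close>, nonzero as the angle is not right. So \<open>\<sigma>\<close> vanishes at the vertices, hence
  everywhere. There are at most nine degrees of freedom and the space has dimension at least nine, so
  injectivity gives unisolvence.
\<close>

section \<open>Linear algebra: dual families and unisolvence\<close>

text \<open>\<open>E j\<close> kills the span of the other vectors but takes the value 1 at
  \<open>v j\<close>. The lemma serves twice: for forms tested by evaluation, and for nine explicit
  matrix fields.\<close>

lemma biorthogonal_independent:
  fixes v :: "'i \<Rightarrow> 'v::real_vector" and E :: "'i \<Rightarrow> 'v \<Rightarrow> real"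
  assumes lin: "\<And>i. i \<in> J \<Longrightarrow> linear (E i)"
    and E: "\<And>i j. i \<in> J \<Longrightarrow> j \<in> J \<Longrightarrow> E i (v j) = (if i = j then 1 else 0)"
  shows "inj_on v J" and "independent (v ` J)"
proof -
  show "inj_on v J"
    by (rule inj_onI) (metis E zero_neq_one)
  show "independent (v ` J)"
    unfolding dependent_def
  proof (clarsimp)
    fix j assume j: "j \<in> J" and *: "v j \<in> span (v ` J - {v j})"
    have "E j (v j) = 0"
    proof (rule linear_eq_0_on_span[OF lin[OF j] _ *])
      fix x assume "x \<in> v ` J - {v j}"
      then show "E j x = 0"
        using E[OF j] by (auto split: if_splits)
    qed
    then show False
      using E[OF j j] by simp
  qed
qed

text \<open>Linearity is asked on \<open>V\<close> only: on arbitrary fields the integrand of an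
  edge moment may fail to be integrable, where \<open>integral\<close> defaults to 0 and need not be
  additive.\<close>

definition linear_form_on :: "'v::real_vector set \<Rightarrow> ('v \<Rightarrow> real) \<Rightarrow> bool"
  where "linear_form_on V \<phi> \<longleftrightarrow> (\<forall>u\<in>V. \<forall>v\<in>V. \<phi> (u + v) = \<phi> u + \<phi> v) \<and>
                            (\<forall>c. \<forall>u\<in>V. \<phi> (c *\<^sub>R u) = c * \<phi> u)"

text \<open>Extending from a basis of \<open>V\<close> gives a map that is linear on the whole type,
  so that the library facts about \<open>linear\<close> apply.\<close>

lemma linear_form_on_extend:
  assumes V: "subspace V" and \<phi>: "linear_form_on V \<phi>"
  obtains g where "linear g" "\<And>v. v \<in> V \<Longrightarrow> g v = \<phi> v"
proof -
  obtain B where B: "B \<subseteq> V" "independent B" "V \<subseteq> span B"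
    using maximal_independent_subset[of V] by blast
  obtain g where g: "linear g" "\<forall>x\<in>B. g x = \<phi> x"
    using linear_independent_extend[OF B(2)] by blast
  have "v \<in> V \<and> g v = \<phi> v" if "v \<in> span B" for v
  proof (rule span_induct_alt[OF that])
    have "\<phi> 0 = 0"
      using \<phi> subspace_0[OF V] unfolding linear_form_on_def by (metis scaleR_zero_left mult_zero_left)
    then show "0 \<in> V \<and> g 0 = \<phi> 0"
      using g(1) subspace_0[OF V] by (simp add: linear_0)
  next
    fix c x y assume "x \<in> B" and "y \<in> V \<and> g y = \<phi> y"
    moreover from this have "x \<in> V" "c *\<^sub>R x \<in> V"
      using B(1) V by (auto intro: subspace_scale)
    ultimately show "c *\<^sub>R x + y \<in> V \<and> g (c *\<^sub>R x + y) = \<phi> (c *\<^sub>R x + y)"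
      using g \<phi> V unfolding linear_form_on_def
      by (simp add: linear_add linear_scale subspace_add)
  qed
  then show ?thesis
    using that g(1) B(3) by blast
qed

lemma linear_apply: "linear (\<lambda>\<phi> :: 'a \<Rightarrow> 'b::real_vector. \<phi> x)"
  by (rule linearI) (simp_all add: scaleR_fun_def)

lemma subspace_dual_space: "subspace (dual_space V)"
  unfolding subspace_def dual_space_def by (simp add: scaleR_fun_def algebra_simps)

lemma restrict_form_in_dual_space:
  assumes "subspace V" "linear_form_on V \<phi>"
  shows "restrict_form V \<phi> \<in> dual_space V"
  using assms by (auto simp: dual_space_def restrict_form_def linear_form_on_def
      subspace_add subspace_scale)

text \<open>Evaluation at the \<open>w i\<close> separates the restricted forms, which makes them
  independent. Any \<open>v\<close> in \<open>V\<close> is the sum of the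
  \<open>L j v *\<^sub>R w j\<close>, since the difference is annihilated by all \<open>L i\<close>;
  applying \<open>\<phi>\<close> to this expansion writes \<open>\<phi>\<close> as a combination of
  the forms.\<close>

lemma unisolvent_if_dual_family:
  assumes V: "subspace V" and I: "finite I"
    and L: "\<And>i. i \<in> I \<Longrightarrow> linear_form_on V (L i)"
    and ker: "\<And>v. v \<in> V \<Longrightarrow> (\<And>i. i \<in> I \<Longrightarrow> L i v = 0) \<Longrightarrow> v = 0"
    and w: "\<And>i. i \<in> I \<Longrightarrow> w i \<in> V"
    and Lw: "\<And>i j. i \<in> I \<Longrightarrow> j \<in> I \<Longrightarrow> L i (w j) = (if i = j then 1 else 0)"
  shows "unisolvent V I L"
proof -
  define R where "R i = restrict_form V (L i)" for i
  have R: "R i v = (if v \<in> V then L i v else 0)" for i v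
    by (simp add: R_def restrict_form_def)
  have E: "R j (w i) = (if i = j then 1 else 0)" if "i \<in> I" "j \<in> I" for i j
    using that by (auto simp: R w Lw)
  \<comment> \<open>The roles are exchanged here: the vectors are the forms \<open>R i\<close>, and
    the functionals on them are the evaluations at \<open>w i\<close>.\<close>
  note bi = biorthogonal_independent[where J = I and E = "\<lambda>i \<phi>. \<phi> (w i)" and v = R, OF linear_apply E]
  have "span (R ` I) \<subseteq> dual_space V"
    using V L by (intro span_minimal subspace_dual_space) (auto simp: R_def restrict_form_in_dual_space)
  moreover have "\<phi> \<in> span (R ` I)" if \<phi>: "\<phi> \<in> dual_space V" for \<phi>
  proof -
    have lin: "linear_form_on V \<phi>" and out: "\<And>u. u \<notin> V \<Longrightarrow> \<phi> u = 0"
      using \<phi> by (auto simp: dual_space_def linear_form_on_def)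
    obtain g where g: "linear g" "\<And>v. v \<in> V \<Longrightarrow> g v = \<phi> v"
      using linear_form_on_extend[OF V lin] by blast
    \<comment> \<open>The equality must hold on the whole type; outside \<open>V\<close> both sides
      are 0 by the convention in \<open>dual_space\<close> and \<open>restrict_form\<close>.\<close>
    have "\<phi> v = (\<Sum>i\<in>I. \<phi> (w i) *\<^sub>R R i) v" for v
    proof (cases "v \<in> V")
      case True
      define u where "u = v - (\<Sum>j\<in>I. L j v *\<^sub>R w j)"
      have u: "u \<in> V"
        unfolding u_def using V True w by (intro subspace_diff subspace_sum subspace_scale)
      have "L i u = 0" if i: "i \<in> I" for i
      proof -
        obtain h where h: "linear h" "\<And>v. v \<in> V \<Longrightarrow> h v = L i v"
          using linear_form_on_extend[OF V L[OF i]] by blast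
        have "L i u = h u"
          using h u by simp
        also have "\<dots> = L i v - (\<Sum>j\<in>I. L j v * L i (w j))"
          unfolding u_def using h True w
          by (simp add: linear_diff linear_sum linear_scale)
        also have "\<dots> = 0"
          using i I by (simp add: Lw if_distrib cong: if_cong)
        finally show ?thesis .
      qed
      then have "v = (\<Sum>j\<in>I. L j v *\<^sub>R w j)"
        using ker[OF u] by (simp add: u_def)
      then have "g v = g (\<Sum>j\<in>I. L j v *\<^sub>R w j)"
        by simp
      also have "\<dots> = (\<Sum>j\<in>I. L j v * \<phi> (w j))"
        using g w by (simp add: linear_sum linear_scale)
      finally have "\<phi> v = (\<Sum>j\<in>I. L j v * \<phi> (w j))"
        using g True by simp
      then show ?thesis
        using True by (simp add: linear_sum[OF linear_apply] R scaleR_fun_def mult.commute)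
    next
      case False
      then show ?thesis
        by (simp add: linear_sum[OF linear_apply] R scaleR_fun_def out)
    qed
    then have "\<phi> = (\<Sum>i\<in>I. \<phi> (w i) *\<^sub>R R i)"
      by (rule ext)
    moreover have "(\<Sum>i\<in>I. \<phi> (w i) *\<^sub>R R i) \<in> span (R ` I)"
      by (intro span_sum span_scale span_base imageI)
    \<comment> \<open>\<open>\<phi>\<close> occurs on both sides of the equation, so it is
      substituted once; as a rewrite rule the equation would loop.\<close>
    ultimately show ?thesis
      by (rule ssubst[where P = "\<lambda>x. x \<in> span (R ` I)"])
  qed
  ultimately have "span (R ` I) = dual_space V"
    by blast
  moreover have "R = (\<lambda>i. restrict_form V (L i))"
    by (simp add: R_def fun_eq_iff)
  ultimately show ?thesis
    using bi unfolding unisolvent_def basis_of_def by auto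
qed

text \<open>A dimension count turns injectivity into a dual family: the map \<open>\<Phi>\<close>
  collecting all forms is injective on \<open>span S\<close>, so its image has at least
  \<open>card I\<close> independent vectors among the functions supported on \<open>I\<close>. Hence
  every unit vector \<open>e i\<close> is attained, and its preimage is \<open>w i\<close>.\<close>

lemma unisolventI:
  fixes V :: "'v::real_vector set" and L :: "'i \<Rightarrow> 'v \<Rightarrow> real"
  assumes V: "subspace V" and I: "finite I"
    and L: "\<And>i. i \<in> I \<Longrightarrow> linear_form_on V (L i)"
    and ker: "\<And>v. v \<in> V \<Longrightarrow> (\<And>i. i \<in> I \<Longrightarrow> L i v = 0) \<Longrightarrow> v = 0"
    and S: "S \<subseteq> V" "independent S" "finite S" "card I \<le> card S"
  shows "unisolvent V I L"
proof -
  have "\<forall>i\<in>I. \<exists>g. linear g \<and> (\<forall>v\<in>V. g v = L i v)"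
    using linear_form_on_extend[OF V L] by metis
  then obtain g where g: "\<And>i. i \<in> I \<Longrightarrow> linear (g i)" "\<And>i v. i \<in> I \<Longrightarrow> v \<in> V \<Longrightarrow> g i v = L i v"
    by metis
  \<comment> \<open>Using the extensions \<open>g i\<close> makes \<open>\<Phi>\<close> linear
    everywhere; the value 0 off \<open>I\<close> keeps its range inside the span of the finitely
    many \<open>e i\<close>.\<close>
  define \<Phi> :: "'v \<Rightarrow> 'i \<Rightarrow> real" where "\<Phi> v = (\<lambda>i. if i \<in> I then g i v else 0)" for v
  define e :: "'i \<Rightarrow> 'i \<Rightarrow> real" where "e i = (\<lambda>k. if k = i then 1 else 0)" for i
  have lin: "linear \<Phi>"
    by (rule linearI) (auto simp: \<Phi>_def fun_eq_iff scaleR_fun_def g linear_add linear_scale)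
  have spS: "span S \<subseteq> V"
    using S V by (simp add: span_minimal)
  have inj: "inj_on \<Phi> (span S)"
  proof (subst linear_inj_on_iff_eq_0[OF lin subspace_span], intro ballI impI)
    fix v assume v: "v \<in> span S" "\<Phi> v = 0"
    show "v = 0"
    proof (rule ker)
      show "v \<in> V" using v spS by blast
      fix i assume "i \<in> I"
      then show "L i v = 0"
        using fun_cong[OF v(2), of i] g(2)[of i v] \<open>v \<in> V\<close> by (simp add: \<Phi>_def)
    qed
  qed
  have ind: "independent (\<Phi> ` S)"
    by (rule linear_independent_injective_image[OF lin S(2) inj])
  have card: "card (\<Phi> ` S) = card S"
    using inj span_superset by (intro card_image) (rule inj_on_subset)
  have supp: "h \<in> span (e ` I)" if "\<And>k. k \<notin> I \<Longrightarrow> h k = 0" for h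
  proof -
    have "h = (\<Sum>i\<in>I. h i *\<^sub>R e i)"
    proof
      fix k
      show "h k = (\<Sum>i\<in>I. h i *\<^sub>R e i) k"
        using I that[of k] by (auto simp: linear_sum[OF linear_apply] scaleR_fun_def e_def if_distrib cong: if_cong)
    qed
    moreover have "(\<Sum>i\<in>I. h i *\<^sub>R e i) \<in> span (e ` I)"
      by (intro span_sum span_scale span_base imageI)
    ultimately show ?thesis
      by (rule ssubst[where P = "\<lambda>x. x \<in> span (e ` I)"])
  qed
  \<comment> \<open>Otherwise \<open>e i\<close> would enlarge \<open>\<Phi> ` S\<close> to an independent set with more than \<open>card I\<close> elements.\<close>
  have "e i \<in> \<Phi> ` span S" if i: "i \<in> I" for i
  proof (rule ccontr)
    assume "e i \<notin> \<Phi> ` span S"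
    then have ni: "e i \<notin> span (\<Phi> ` S)"
      by (simp add: linear_span_image[OF lin])
    then have "independent (insert (e i) (\<Phi> ` S))"
      using ind by (simp add: independent_insert)
    moreover have "insert (e i) (\<Phi> ` S) \<subseteq> span (e ` I)"
      using i by (auto simp: span_base intro!: supp) (simp add: \<Phi>_def)
    ultimately have "card (insert (e i) (\<Phi> ` S)) \<le> card (e ` I)"
      using independent_span_bound[of "e ` I"] I by blast
    moreover have "e i \<notin> \<Phi> ` S"
      using ni by (rule contra_subsetD[OF span_superset])
    ultimately show False
      using card S(3,4) card_image_le[OF I, of e] by simp
  qed
  then have "\<forall>i\<in>I. \<exists>x. x \<in> span S \<and> \<Phi> x = e i"
    by (metis imageE)
  then obtain w where w: "\<And>i. i \<in> I \<Longrightarrow> w i \<in> span S" "\<And>i. i \<in> I \<Longrightarrow> \<Phi> (w i) = e i"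
    by metis
  show ?thesis
  proof (rule unisolvent_if_dual_family[OF V I L ker])
    show wV: "w i \<in> V" if "i \<in> I" for i
      using w(1) spS that by blast
    show "L i (w j) = (if i = j then 1 else 0)" if "i \<in> I" "j \<in> I" for i j
      using fun_cong[OF w(2)[OF that(2)], of i] g(2)[OF that(1) wV[OF that(2)]] that
      by (simp add: \<Phi>_def e_def)
  qed
qed

section \<open>Affine functions and affine matrix fields\<close>

text \<open>Because of the extension by 0, affinity along a segment holds only while the segment
  stays in \<open>s\<close>; convexity ensures this.\<close>

lemma P1_affine:
  assumes "p \<in> P1 s" "convex s" "x \<in> s" "y \<in> s" "t \<in> {0..1}"
  shows "p (linepath x y t) = (1 - t) * p x + t * p y"
proof -
  obtain a b where p: "p = (\<lambda>x. if x \<in> s then a + b \<bullet> x else 0)"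
    using assms(1) by (auto simp: P1_def)
  have "linepath x y t \<in> s"
    using assms unfolding linepath_def by (intro convexD_alt) auto
  then show ?thesis
    using assms by (simp add: p linepath_def inner_add_right algebra_simps)
qed

lemma subspace_S2: "subspace S2"
  by (auto simp: subspace_def S2_def transpose_def vec_eq_iff)

text \<open>The three properties hold for pure tensors and define a subspace \<open>U\<close>, so
  they pass to the span.\<close>

lemma P1_S2_field:
  assumes f: "convex f" and \<sigma>: "\<sigma> \<in> P1_S2 f"
  shows "x \<notin> f \<Longrightarrow> \<sigma> x = 0" and "\<sigma> x \<in> S2"
    and "x \<in> f \<Longrightarrow> y \<in> f \<Longrightarrow> t \<in> {0..1} \<Longrightarrow> \<sigma> (linepath x y t) = (1 - t) *\<^sub>R \<sigma> x + t *\<^sub>R \<sigma> y"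
proof -
  define U :: "(real^2 \<Rightarrow> real^2^2) set" where "U = {\<sigma>. (\<forall>x. x \<notin> f \<longrightarrow> \<sigma> x = 0) \<and> (\<forall>x. \<sigma> x \<in> S2) \<and>
    (\<forall>x\<in>f. \<forall>y\<in>f. \<forall>t\<in>{0..1}. \<sigma> (linepath x y t) = (1 - t) *\<^sub>R \<sigma> x + t *\<^sub>R \<sigma> y)}"
  have "subspace U"
    unfolding subspace_def U_def
    by (auto simp: scaleR_fun_def subspace_0[OF subspace_S2] subspace_add[OF subspace_S2]
        subspace_scale[OF subspace_S2] scaleR_add_right mult.commute add_ac)
  moreover have "(\<lambda>x. p x *\<^sub>R A) \<in> U" if p: "p \<in> P1 f" and A: "A \<in> S2" for p A
    unfolding U_def
  proof (intro CollectI conjI allI impI ballI)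
    show "p x *\<^sub>R A = 0" if "x \<notin> f" for x
      using p that by (auto simp: P1_def)
    show "p x *\<^sub>R A \<in> S2" for x
      by (rule subspace_scale[OF subspace_S2 A])
    show "p (linepath x y t) *\<^sub>R A = (1 - t) *\<^sub>R p x *\<^sub>R A + t *\<^sub>R p y *\<^sub>R A"
      if "x \<in> f" "y \<in> f" "t \<in> {0..1}" for x y t
      by (simp only: P1_affine[OF p f that] scaleR_add_left scaleR_scaleR)
  qed
  ultimately have "P1_S2 f \<subseteq> U"
    unfolding P1_S2_def by (intro span_minimal) auto
  with \<sigma> have "\<sigma> \<in> U" by blast
  then show "x \<notin> f \<Longrightarrow> \<sigma> x = 0" and "\<sigma> x \<in> S2"
    and "x \<in> f \<Longrightarrow> y \<in> f \<Longrightarrow> t \<in> {0..1} \<Longrightarrow> \<sigma> (linepath x y t) = (1 - t) *\<^sub>R \<sigma> x + t *\<^sub>R \<sigma> y"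
    by (auto simp: U_def)
qed

text \<open>By affinity the zero set inside the hull is convex, and it contains \<open>C\<close>, so
  it is the whole hull.\<close>

lemma P1_S2_eq_0:
  assumes \<sigma>: "\<sigma> \<in> P1_S2 (convex hull C)" and 0: "\<And>x. x \<in> C \<Longrightarrow> \<sigma> x = 0"
  shows "\<sigma> = 0"
proof -
  note field = P1_S2_field[OF convex_convex_hull \<sigma>]
  have "convex {x \<in> convex hull C. \<sigma> x = 0}"
  proof (rule convexI)
    fix x y and u v :: real
    assume *: "x \<in> {x \<in> convex hull C. \<sigma> x = 0}" "y \<in> {x \<in> convex hull C. \<sigma> x = 0}"
      "0 \<le> u" "0 \<le> v" "u + v = 1"
    then have "u *\<^sub>R x + v *\<^sub>R y = linepath x y v"
      by (simp add: linepath_def)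
    with * show "u *\<^sub>R x + v *\<^sub>R y \<in> {x \<in> convex hull C. \<sigma> x = 0}"
      using field(3)[of x y v] convexD[OF convex_convex_hull, of x C y u v] by auto
  qed
  then have "convex hull C \<subseteq> {x \<in> convex hull C. \<sigma> x = 0}"
    using 0 by (intro hull_minimal) (auto simp: hull_inc)
  then show ?thesis
    using field(1) by (force simp: fun_eq_iff)
qed

text \<open>On a segment only the component of the gradient along \<open>b - a\<close> is visible,
  so the constant \<open>h\<close> and the linear function \<open>k\<close> span. This caps the
  number of moments per edge.\<close>

lemma P1_closed_segment_dim_le:
  assumes "a \<noteq> b" "independent B" "B \<subseteq> P1 (closed_segment a b)"
  shows "finite B" "card B \<le> 2"
proof -
  let ?e = "closed_segment a b"
  define h where "h = (\<lambda>x. if x \<in> ?e then 1 else 0 :: real)"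
  define k where "k = (\<lambda>x. if x \<in> ?e then (b - a) \<bullet> x else 0)"
  have "p \<in> span {h, k}" if p: "p \<in> P1 ?e" for p
  proof -
    obtain \<alpha> \<beta> where p: "p = (\<lambda>x. if x \<in> ?e then \<alpha> + \<beta> \<bullet> x else 0)"
      using p unfolding P1_def by blast
    \<comment> \<open>\<open>c *\<^sub>R (b - a)\<close> is the orthogonal projection of the
      gradient \<open>\<beta>\<close> onto the edge direction.\<close>
    define c where "c = (\<beta> \<bullet> (b - a)) / ((b - a) \<bullet> (b - a))"
    have c: "c * ((b - a) \<bullet> (b - a)) = \<beta> \<bullet> (b - a)"
      using \<open>a \<noteq> b\<close> by (simp add: c_def)
    have "p x = ((\<alpha> + \<beta> \<bullet> a - c * ((b - a) \<bullet> a)) *\<^sub>R h + c *\<^sub>R k) x" for x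
    proof (cases "x \<in> ?e")
      case True
      then obtain t where x: "x = a + t *\<^sub>R (b - a)"
        by (auto simp: in_segment algebra_simps)
      have "\<beta> \<bullet> x = \<beta> \<bullet> a + t * (\<beta> \<bullet> (b - a))"
        by (simp only: x inner_add_right inner_scaleR_right)
      also have "\<dots> = \<beta> \<bullet> a + t * (c * ((b - a) \<bullet> (b - a)))"
        by (simp only: c)
      also have "\<dots> = \<beta> \<bullet> a + c * (t * ((b - a) \<bullet> (b - a)))"
        by simp
      also have "t * ((b - a) \<bullet> (b - a)) = (b - a) \<bullet> x - (b - a) \<bullet> a"
        by (simp only: x inner_add_right inner_scaleR_right)
      finally show ?thesis
        using True by (simp add: p h_def k_def scaleR_fun_def right_diff_distrib)
    qed (simp add: p h_def k_def scaleR_fun_def)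
    then have "p = (\<alpha> + \<beta> \<bullet> a - c * ((b - a) \<bullet> a)) *\<^sub>R h + c *\<^sub>R k"
      by (rule ext)
    then show ?thesis
      by (simp add: span_add span_scale span_base)
  qed
  then have "B \<subseteq> span {h, k}"
    using assms(3) by blast
  from independent_span_bound[OF _ assms(2) this]
  have "finite B \<and> card B \<le> card {h, k}" by simp
  moreover have "card {h, k} \<le> 2"
    by (simp add: card_insert_if)
  ultimately show "finite B" "card B \<le> 2"
    by auto
qed

section \<open>Tangential components and edge moments\<close>

definition tangential :: "real^2 \<Rightarrow> (real^2 \<Rightarrow> real^2^2) \<Rightarrow> real^2 \<Rightarrow> real"
  where "tangential \<tau> \<sigma> x = \<tau> \<bullet> (\<sigma> x *v \<tau>)"

lemma tangential_affine:
  assumes "convex f" "\<sigma> \<in> P1_S2 f" "x \<in> f" "y \<in> f" "t \<in> {0..1}"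
  shows "tangential \<tau> \<sigma> (linepath x y t) = (1 - t) * tangential \<tau> \<sigma> x + t * tangential \<tau> \<sigma> y"
  unfolding tangential_def P1_S2_field(3)[OF assms]
  by (simp add: matrix_vector_mult_add_rdistrib inner_add_right scaleR_matrix_vector_assoc[symmetric])

text \<open>Along the edge the integrand is a product of two affine functions of \<open>t\<close>,
  hence continuous.\<close>

lemma edge_integrand_integrable:
  assumes "convex f" "\<sigma> \<in> P1_S2 f" "closed_segment a b \<subseteq> f" "p \<in> P1 (closed_segment a b)"
  shows "(\<lambda>t. tangential \<tau> \<sigma> (linepath a b t) * p (linepath a b t)) integrable_on {0..1}"
proof -
  have ab: "a \<in> f" "b \<in> f" using assms(3) by auto
  let ?g = "tangential \<tau> \<sigma>"
  have "(\<lambda>t. ((1 - t) * ?g a + t * ?g b) * ((1 - t) * p a + t * p b)) integrable_on {0..1::real}"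
    by (intro integrable_continuous_interval continuous_intros)
  then show ?thesis
    by (rule integrable_eq) (simp add: tangential_affine[OF assms(1,2) ab] P1_affine[OF assms(4)])
qed

lemma linear_form_on_edge_integral:
  assumes "convex f" "closed_segment a b \<subseteq> f" "p \<in> P1 (closed_segment a b)"
  shows "linear_form_on (P1_S2 f) (\<lambda>\<sigma>. edge_integral (closed_segment a b) (\<lambda>x. tangential \<tau> \<sigma> x * p x))"
proof -
  note int = edge_integrand_integrable[OF assms(1) _ assms(2,3), of _ \<tau>]
  have add: "tangential \<tau> (u + v) x = tangential \<tau> u x + tangential \<tau> v x" for u v x
    by (simp add: tangential_def matrix_vector_mult_add_rdistrib inner_add_right)
  have scale: "tangential \<tau> (c *\<^sub>R u) x = c * tangential \<tau> u x" for c u x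
    by (simp add: tangential_def scaleR_fun_def scaleR_matrix_vector_assoc[symmetric])
  show ?thesis
    unfolding linear_form_on_def edge_integral_closed_segment
    by (auto simp: add scale distrib_right int integral_add distrib_left mult.assoc)
qed

text \<open>By linearity the moments against all of \<open>P1\<close> of the edge vanish. Testing
  with the \<open>q\<close> that coincides with the tangential component on the edge gives a zero
  integral of a continuous square, which is therefore zero, in particular at \<open>t = 0\<close>
  and \<open>t = 1\<close>.\<close>

lemma edge_moments_eq_0:
  assumes f: "convex f" and \<sigma>: "\<sigma> \<in> P1_S2 f" and ab: "closed_segment a b \<subseteq> f" "a \<noteq> b"
    and B: "basis_of (P1 (closed_segment a b)) B"
    and 0: "\<And>p. p \<in> B \<Longrightarrow> edge_integral (closed_segment a b) (\<lambda>x. tangential \<tau> \<sigma> x * p x) = 0"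
  shows "tangential \<tau> \<sigma> a = 0" "tangential \<tau> \<sigma> b = 0"
proof -
  let ?e = "closed_segment a b" and ?g = "tangential \<tau> \<sigma>"
  define W where "W = {p. ((\<lambda>t. ?g (linepath a b t) * p (linepath a b t)) has_integral 0) {0..1}}"
  have span: "span B = P1 ?e"
    using B by (simp add: basis_of_def)
  have "subspace W"
    unfolding subspace_def W_def
  proof (safe)
    fix p q and c :: real
    assume p: "((\<lambda>t. ?g (linepath a b t) * p (linepath a b t)) has_integral 0) {0..1}"
    show "((\<lambda>t. ?g (linepath a b t) * (c *\<^sub>R p) (linepath a b t)) has_integral 0) {0..1}"
      using has_integral_mult_right[OF p, of c] by (simp add: scaleR_fun_def mult.left_commute)
    assume q: "((\<lambda>t. ?g (linepath a b t) * q (linepath a b t)) has_integral 0) {0..1}"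
    show "((\<lambda>t. ?g (linepath a b t) * (p + q) (linepath a b t)) has_integral 0) {0..1}"
      using has_integral_add[OF p q] by (simp add: distrib_left)
  qed simp
  moreover have "B \<subseteq> W"
  proof
    fix p assume p: "p \<in> B"
    then have "p \<in> P1 ?e"
      using span span_base by blast
    \<comment> \<open>As \<open>a \<noteq> b\<close>, the length factor \<open>dist a b\<close> can
      be cancelled from the moment.\<close>
    from edge_integrand_integrable[OF f \<sigma> ab(1) this, of \<tau>] 0[OF p] ab(2)
    show "p \<in> W"
      by (simp add: W_def edge_integral_closed_segment has_integral_integrable_integral)
  qed
  ultimately have W: "P1 ?e \<subseteq> W"
    using span span_minimal by blast
  \<comment> \<open>The slope \<open>d\<close> along \<open>b - a\<close> and the constant term are
    chosen so that \<open>q\<close> takes the values of the tangential component at both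
    endpoints.\<close>
  define d where "d = (?g b - ?g a) / ((b - a) \<bullet> (b - a))"
  define q where "q = (\<lambda>x. if x \<in> ?e then (?g a - d * ((b - a) \<bullet> a)) + (d *\<^sub>R (b - a)) \<bullet> x else 0)"
  have qP: "q \<in> P1 ?e"
    unfolding P1_def q_def by blast
  have qa: "q a = ?g a"
    by (simp add: q_def)
  have "q b = ?g a + d * ((b - a) \<bullet> (b - a))"
    by (simp add: q_def inner_diff_right algebra_simps)
  then have qb: "q b = ?g b"
    using ab(2) by (simp add: d_def)
  have "((\<lambda>t. ((1 - t) * ?g a + t * ?g b)\<^sup>2) has_integral 0) {0..1::real}"
  proof (rule has_integral_eq)
    show "((\<lambda>t. ?g (linepath a b t) * q (linepath a b t)) has_integral 0) {0..1}"
      using W qP by (auto simp: W_def)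
    fix t :: real assume t: "t \<in> {0..1}"
    show "?g (linepath a b t) * q (linepath a b t) = ((1 - t) * ?g a + t * ?g b)\<^sup>2"
      using tangential_affine[OF f \<sigma> _ _ t, of a b \<tau>] P1_affine[OF qP _ _ _ t, of a b] ab
      by (auto simp: qa qb power2_eq_square)
  qed
  then have *: "((1 - t) * ?g a + t * ?g b)\<^sup>2 = 0" if "t \<in> {0..1}" for t
    using that by (intro has_integral_0_cbox_imp_0[of 0 1 "\<lambda>t. ((1 - t) * ?g a + t * ?g b)\<^sup>2"])
      (auto intro!: continuous_intros)
  show "?g a = 0" "?g b = 0"
    using *[of 0] *[of 1] by auto
qed

section \<open>Algebra at a vertex\<close>

definition cross2 :: "real^2 \<Rightarrow> real^2 \<Rightarrow> real"
  where "cross2 u w = u$1 * w$2 - u$2 * w$1"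

text \<open>By Lagrange's identity a zero determinant means equality in Cauchy-Schwarz, hence
  collinearity.\<close>

lemma cross2_nonzero:
  assumes "\<not> collinear {a, b, c}"
  shows "cross2 (a - b) (c - b) \<noteq> 0"
proof
  let ?u = "a - b" and ?w = "c - b"
  assume "cross2 ?u ?w = 0"
  moreover have "(?u \<bullet> ?w)\<^sup>2 + (cross2 ?u ?w)\<^sup>2 = (?u \<bullet> ?u) * (?w \<bullet> ?w)"
    by (simp add: cross2_def inner_vec_def sum_2 power2_eq_square algebra_simps)
  ultimately have "(?u \<bullet> ?w)\<^sup>2 = (norm ?u * norm ?w)\<^sup>2"
    by (simp add: power_mult_distrib power2_norm_eq_inner)
  then have "\<bar>?u \<bullet> ?w\<bar> = norm ?u * norm ?w"
    by (auto simp: power2_eq_iff abs_mult)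
  then have "collinear {0, ?u, ?w}"
    by (simp add: norm_cauchy_schwarz_equal)
  then show False
    using assms by (simp add: collinear_3)
qed

text \<open>Read as complex numbers, \<open>u\<close> and \<open>w\<close> enter the equations for
  the two free entries through their squares. The determinant is thus proportional to the sine of
  twice the angle and vanishes for nonzero vectors only if they are parallel or
  perpendicular.\<close>

lemma symmetric_traceless_eq_0:
  fixes M :: "real^2^2"
  assumes M: "M \<in> S2" "trace M = 0"
    and u: "u \<bullet> (M *v u) = 0" and w: "w \<bullet> (M *v w) = 0"
    and uw: "u \<bullet> w \<noteq> 0" "cross2 u w \<noteq> 0"
  shows "M = 0"
proof -
  have sym: "M$2$1 = M$1$2"
    using M(1) by (simp add: S2_def transpose_def vec_eq_iff)
  have tr: "M$2$2 = - M$1$1"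
    using M(2) by (simp add: trace_def sum_2)
  define m n where "m = M$1$1" and "n = M$1$2"
  have e: "m * (u$1 * u$1 - u$2 * u$2) + 2 * n * (u$1 * u$2) = 0"
    "m * (w$1 * w$1 - w$2 * w$2) + 2 * n * (w$1 * w$2) = 0"
    using u w by (simp_all add: matrix_vector_mult_def inner_vec_def sum_2 sym tr m_def n_def algebra_simps)
  \<comment> \<open>Cramer's rule: each unknown times the determinant of the system.\<close>
  have "m * (2 * (u \<bullet> w) * cross2 u w) = 0" "n * (2 * (u \<bullet> w) * cross2 u w) = 0"
    using e unfolding inner_vec_def cross2_def sum_2 inner_real_def by algebra+
  then have "m = 0" "n = 0"
    using uw by auto
  then show ?thesis
    by (simp add: vec_eq_iff forall_2 sym tr m_def n_def)
qed

text \<open>A segment determines its endpoints only as an unordered pair, so the sign of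
  \<open>k\<close> is open; the quadratic form of \<open>\<sigma>\<close> sees only
  \<open>k\<^sup>2\<close>.\<close>

lemma unit_tangent_closed_segment:
  assumes "unit_tangent (closed_segment a b) \<tau>"
  obtains k where "k \<noteq> 0" "\<tau> = k *\<^sub>R (b - a)"
proof -
  obtain c d where cd: "c \<noteq> d" "closed_segment a b = closed_segment c d" "\<tau> = (1 / norm (d - c)) *\<^sub>R (d - c)"
    using assms by (auto simp: unit_tangent_def)
  then have "{a, b} = {c, d}" by simp
  then consider "c = a" "d = b" | "c = b" "d = a"
    by (auto simp: doubleton_eq_iff)
  then show ?thesis
  proof cases
    case 1
    then show ?thesis using cd that[of "1 / norm (d - c)"] by simp
  next
    case 2
    then have "\<tau> = (- 1 / norm (d - c)) *\<^sub>R (b - a)"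
      using cd by (simp add: algebra_simps)
    then show ?thesis using cd that[of "- 1 / norm (d - c)"] by simp
  qed
qed

lemma tangential_scale: "tangential (k *\<^sub>R v) \<sigma> x = k\<^sup>2 * (v \<bullet> (\<sigma> x *v v))"
  by (simp add: tangential_def matrix_vector_mult_scaleR power2_eq_square)

section \<open>Nine independent fields\<close>

text \<open>This is the barycentric coordinate of \<open>a\<close>, written as a quotient of signed
  areas.\<close>

lemma nodal_function:
  assumes "\<not> collinear {a, b, c}" "a \<in> f" "b \<in> f" "c \<in> f"
  obtains p where "p \<in> P1 f" "p a = 1" "p b = 0" "p c = 0"
proof -
  let ?D = "cross2 (a - b) (c - b)"
  \<comment> \<open>\<open>m\<close> is \<open>c - b\<close> turned by a quarter turn, which makes
    \<open>cross2\<close> with \<open>c - b\<close> an inner product, as \<open>P1\<close>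
    requires.\<close>
  define m :: "real^2" where "m = vector [(c - b)$2, - ((c - b)$1)]"
  have m: "m \<bullet> z = cross2 z (c - b)" for z
    by (simp add: m_def inner_vec_def sum_2 cross2_def algebra_simps)
  define n where "n = (1 / ?D) *\<^sub>R m"
  define p where "p = (\<lambda>x. if x \<in> f then - (n \<bullet> b) + n \<bullet> x else 0)"
  have p: "p x = cross2 (x - b) (c - b) / ?D" if "x \<in> f" for x
  proof -
    have "p x = n \<bullet> (x - b)"
      using that by (simp add: p_def inner_diff_right)
    then show ?thesis
      by (simp add: n_def m)
  qed
  show ?thesis
  proof (rule that)
    show "p \<in> P1 f"
      unfolding P1_def p_def by blast
    show "p a = 1" "p b = 0" "p c = 0"
      using assms cross2_nonzero[OF assms(1)] by (simp_all add: p) (simp_all add: cross2_def)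
  qed
qed

text \<open>Three barycentric coordinates times three symmetric matrices; reading off matrix entries
  at the vertices is biorthogonal to these products.\<close>

lemma P1_S2_nine_independent:
  assumes nc: "\<not> collinear {a, b, c}" and f: "a \<in> f" "b \<in> f" "c \<in> f"
  obtains S where "S \<subseteq> P1_S2 f" "independent S" "finite S" "card S = 9"
proof -
  obtain pa where pa: "pa \<in> P1 f" "pa a = 1" "pa b = 0" "pa c = 0"
    using nodal_function[OF nc f] .
  obtain pb where pb: "pb \<in> P1 f" "pb b = 1" "pb c = 0" "pb a = 0"
    using nodal_function[of b c a f] nc f by (auto simp: insert_commute)
  obtain pc where pc: "pc \<in> P1 f" "pc c = 1" "pc a = 0" "pc b = 0"
    using nodal_function[of c a b f] nc f by (auto simp: insert_commute)
  have ne: "a \<noteq> b" "b \<noteq> c" "a \<noteq> c"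
    using nc by (auto simp: insert_commute)
  define q where "q x = (if x = a then pa else if x = b then pb else pc)" for x
  have qP: "q x \<in> P1 f" for x
    by (simp add: q_def pa pb pc)
  have q: "q x y = (if x = y then 1 else 0)" if "x \<in> {a, b, c}" "y \<in> {a, b, c}" for x y
    using that ne by (auto simp: q_def pa pb pc)
  \<comment> \<open>\<open>A\<close> gives symmetrised matrix units. As \<open>(1, 2)\<close> and
    \<open>(2, 1)\<close> yield the same matrix, \<open>J\<close> keeps only the upper triangular
    index pairs.\<close>
  define A :: "2 \<times> 2 \<Rightarrow> real^2^2"
    where "A = (\<lambda>(i, j). \<chi> r s. if (r, s) = (i, j) \<or> (s, r) = (i, j) then 1 else 0)"
  define J :: "((real^2) \<times> 2 \<times> 2) set" where "J = {a, b, c} \<times> {(1, 1), (1, 2), (2, 2)}"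
  define v where "v = (\<lambda>(y, k) x. q y x *\<^sub>R A k)"
  define E :: "(real^2) \<times> 2 \<times> 2 \<Rightarrow> (real^2 \<Rightarrow> real^2^2) \<Rightarrow> real" where "E = (\<lambda>(y, i, j) \<sigma>. \<sigma> y $ i $ j)"
  have lin: "linear (E k)" for k
    by (rule linearI) (auto simp: E_def scaleR_fun_def split: prod.splits)
  have one_two: "(1::2) \<noteq> 2"
    by simp
  have "E k (v l) = (if k = l then 1 else 0)" if "k \<in> J" "l \<in> J" for k l
  proof -
    obtain y i j z i' j' where k: "k = (y, i, j)" and l: "l = (z, i', j')"
      by (metis prod.exhaust)
    show ?thesis
      using that one_two q[of z y] unfolding J_def k l E_def v_def A_def by auto
  qed
  note bi = biorthogonal_independent[where J = J and E = E and v = v, OF lin this]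
  have "A k \<in> S2" for k
    by (auto simp: A_def S2_def transpose_def vec_eq_iff split: prod.splits)
  then have "(\<lambda>x. q y x *\<^sub>R A k) \<in> P1_S2 f" for y k
    unfolding P1_S2_def using qP by (intro span_base) blast
  then have "v k \<in> P1_S2 f" for k
    by (cases k) (simp add: v_def)
  moreover have "card J = 9"
    unfolding J_def using ne by (simp add: card_cartesian_product)
  moreover have "finite J"
    by (simp add: J_def)
  ultimately show ?thesis
    using bi by (intro that[of "v ` J"]) (auto simp: card_image)
qed

section \<open>Edges of a simplex, and unisolvence on a triangle\<close>

text \<open>Faces of the hull of an affinely independent set are the hulls of its subsets, and
  affine dimension 1 singles out the two-point subsets.\<close>

lemma edges_convex_hull:
  assumes "\<not> affine_dependent C"
  shows "edges (convex hull C) = {closed_segment a b | a b. a \<in> C \<and> b \<in> C \<and> a \<noteq> b}"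
proof (intro equalityI subsetI)
  fix e assume "e \<in> edges (convex hull C)"
  then have e: "e face_of convex hull C" "aff_dim e = 1"
    by (auto simp: edges_def edge_of_def)
  then obtain D where D: "D \<subseteq> C" "e = convex hull D"
    using face_of_convex_hull_affine_independent[OF assms] by blast
  have "\<not> affine_dependent D"
    using D assms affine_independent_subset by blast
  then have "card D = 2"
    using e D aff_dim_affine_independent[of D] by (simp add: aff_dim_convex_hull)
  then obtain a b where "D = {a, b}" "a \<noteq> b"
    by (auto simp: card_2_iff)
  then show "e \<in> {closed_segment a b | a b. a \<in> C \<and> b \<in> C \<and> a \<noteq> b}"
    using D by (auto simp: segment_convex_hull)
next
  fix e assume "e \<in> {closed_segment a b | a b. a \<in> C \<and> b \<in> C \<and> a \<noteq> b}"
  then obtain a b where ab: "a \<in> C" "b \<in> C" "a \<noteq> b" "e = convex hull {a, b}"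
    by (auto simp: segment_convex_hull)
  then have "e face_of convex hull C"
    unfolding face_of_convex_hull_affine_independent[OF assms] by (intro exI[of _ "{a, b}"]) simp
  moreover have "aff_dim e = 1"
    using ab by (simp add: aff_dim_convex_hull aff_dim_2)
  ultimately show "e \<in> edges (convex hull C)"
    by (simp add: edges_def edge_of_def)
qed

theorem proposition3p3:
  fixes \<Omega> :: "(real^2) set" and \<T> :: "(real^2) set set" and f :: "(real^2) set"
    and \<tau> :: "(real^2) set \<Rightarrow> real^2"
    and B :: "(real^2) set \<Rightarrow> (real^2 \<Rightarrow> real) set"
  assumes "polygonal_domain \<Omega>"
    and "triangulation_of \<T> \<Omega>"
    and "no_right_angle \<T>"
    and "f \<in> triangles \<T>"
    and "\<And>e. e \<in> edges f \<Longrightarrow> unit_tangent e (\<tau> e)"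
    and "\<And>e. e \<in> edges f \<Longrightarrow> basis_of (P1 e) (B e)"
  shows "unisolvent (P1_S2 f) (dof_indices B f) (dof \<tau>)"
proof -
  note tangent = assms(5) and basis = assms(6)
  have "2 simplex f"
    using assms(4) by (simp add: triangles_def)
  then obtain C where C: "\<not> affine_dependent C" "int (card C) = 2 + 1" "f = convex hull C"
    unfolding simplex_def by auto
  then have "card C = 3" by simp
  then obtain a b c where abc: "C = {a, b, c}" "a \<noteq> b" "b \<noteq> c" "a \<noteq> c"
    by (auto simp: card_3_iff)
  have nc: "\<not> collinear {a, b, c}"
    using C(1) abc by (simp add: collinear_3_eq_affine_dependent)
  have vert: "vertices f = C"
    using extreme_point_of_convex_hull_affine_independent[OF C(1)] by (auto simp: vertices_def C(3))
  have edges: "edges f = {closed_segment x y | x y. x \<in> C \<and> y \<in> C \<and> x \<noteq> y}"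
    using edges_convex_hull[OF C(1)] C(3) by simp
  have conv: "convex f"
    by (simp add: C(3))
  have Cf: "C \<subseteq> f"
    by (simp add: C(3) hull_subset)
  have seg: "closed_segment x y \<subseteq> f" if "x \<in> C" "y \<in> C" for x y
    using that Cf conv by (intro closed_segment_subset) auto
  have PB: "p \<in> P1 e" if "e \<in> edges f" "p \<in> B e" for e p
    using basis[OF that(1)] that(2) by (auto simp: basis_of_def intro: span_base)
  have finB: "finite (B e)" "card (B e) \<le> 2" if e: "e \<in> edges f" for e
  proof -
    obtain x y where xy: "e = closed_segment x y" "x \<noteq> y"
      using e by (auto simp: edges)
    have "independent (B e)" "B e \<subseteq> P1 e"
      using basis[OF e] PB[OF e] by (auto simp: basis_of_def)
    then show "finite (B e)" "card (B e) \<le> 2"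
      using P1_closed_segment_dim_le[of x y "B e"] xy by auto
  qed
  \<comment> \<open>The count proceeds by upper bounds: at most three edges with at most two moments
    each, plus three vertices, give at most nine indices.\<close>
  have edges_sub: "edges f \<subseteq> {closed_segment a b, closed_segment b c, closed_segment a c}"
    unfolding edges abc(1) by (auto simp: closed_segment_commute)
  have fin_edges: "finite (edges f)"
    using edges_sub finite_subset by blast
  have "card (edges f) \<le> card {closed_segment a b, closed_segment b c, closed_segment a c}"
    using edges_sub by (intro card_mono) auto
  also have "\<dots> \<le> 3"
    by (simp add: card_insert_if)
  finally have card_edges: "card (edges f) \<le> 3" .
  have fin: "finite (dof_indices B f)"
    unfolding dof_indices_def vert abc(1) using fin_edges finB by auto
  have "card (SIGMA e:edges f. B e) = (\<Sum>e\<in>edges f. card (B e))"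
    using fin_edges finB by (simp add: card_SigmaI)
  also have "\<dots> \<le> 2 * card (edges f)"
    using sum_bounded_above[of "edges f" "\<lambda>e. card (B e)" 2] finB by simp
  finally have "card (SIGMA e:edges f. B e) \<le> 6"
    using card_edges by simp
  moreover have "card (dof_indices B f) \<le> card C + card (SIGMA e:edges f. B e)"
    unfolding dof_indices_def vert
    using card_Un_le[of "Inl ` C" "Inr ` (SIGMA e:edges f. B e)"]
    by (simp add: card_image)
  ultimately have card: "card (dof_indices B f) \<le> 9"
    using \<open>card C = 3\<close> by simp
  obtain S where S: "S \<subseteq> P1_S2 f" "independent S" "finite S" "card S = 9"
    using P1_S2_nine_independent[OF nc] Cf abc(1) by blast
  have dof_edge: "dof \<tau> (Inr (e, p)) = (\<lambda>\<sigma>. edge_integral e (\<lambda>x. tangential (\<tau> e) \<sigma> x * p x))" for e p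
    by (simp add: tangential_def fun_eq_iff)
  show ?thesis
  proof (rule unisolventI[OF _ fin _ _ S(1-3)])
    show "subspace (P1_S2 f)"
      by (simp add: P1_S2_def)
    show "card (dof_indices B f) \<le> card S"
      using card S(4) by simp
    show "linear_form_on (P1_S2 f) (dof \<tau> i)" if i: "i \<in> dof_indices B f" for i
    proof (cases i)
      case (Inl x)
      then show ?thesis
        by (simp add: linear_form_on_def trace_def sum_2 scaleR_fun_def algebra_simps)
    next
      case (Inr ep)
      then obtain e p where ep: "i = Inr (e, p)" "e \<in> edges f" "p \<in> B e"
        using i by (auto simp: dof_indices_def)
      then obtain x y where xy: "e = closed_segment x y" "x \<in> C" "y \<in> C"
        by (auto simp: edges)
      show ?thesis
        unfolding ep(1) dof_edge unfolding xy(1)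
        using linear_form_on_edge_integral[OF conv seg] PB[OF ep(2,3)] xy by auto
    qed
    fix \<sigma> assume \<sigma>: "\<sigma> \<in> P1_S2 f" and 0: "\<And>i. i \<in> dof_indices B f \<Longrightarrow> dof \<tau> i \<sigma> = 0"
    \<comment> \<open>Since \<open>x\<close> and \<open>y\<close> range over ordered pairs, the
      statement at the first endpoint covers both ends of every edge.\<close>
    have edge0: "(y - x) \<bullet> (\<sigma> x *v (y - x)) = 0" if xy: "x \<in> C" "y \<in> C" "x \<noteq> y" for x y
    proof -
      let ?e = "closed_segment x y"
      have e: "?e \<in> edges f"
        using xy by (auto simp: edges)
      have "edge_integral ?e (\<lambda>x. tangential (\<tau> ?e) \<sigma> x * p x) = 0" if "p \<in> B ?e" for p
        using 0[of "Inr (?e, p)"] e that by (simp add: dof_indices_def dof_edge[unfolded fun_eq_iff] del: dof.simps)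
      from edge_moments_eq_0(1)[OF conv \<sigma> seg[OF xy(1,2)] xy(3) basis[OF e] this]
      have "tangential (\<tau> ?e) \<sigma> x = 0" .
      moreover obtain k where "k \<noteq> 0" "\<tau> ?e = k *\<^sub>R (y - x)"
        using unit_tangent_closed_segment[OF tangent[OF e]] .
      ultimately show ?thesis
        by (simp add: tangential_scale)
    qed
    have vertex0: "\<sigma> x = 0" if xyz: "C = {y, x, z}" "y \<noteq> x" "x \<noteq> z" "y \<noteq> z" for x y z
    proof (rule symmetric_traceless_eq_0)
      show "\<sigma> x \<in> S2"
        by (rule P1_S2_field(2)[OF conv \<sigma>])
      show "trace (\<sigma> x) = 0"
        using 0[of "Inl x"] xyz by (simp add: dof_indices_def vert)
      show "(y - x) \<bullet> (\<sigma> x *v (y - x)) = 0" "(z - x) \<bullet> (\<sigma> x *v (z - x)) = 0"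
        using xyz by (auto intro!: edge0)
      \<comment> \<open>A zero inner product at \<open>x\<close> would give \<open>arccos 0\<close>,
        which is \<open>pi / 2\<close>; here the hypothesis on the angles enters.\<close>
      have "angle_at y x z \<noteq> pi / 2"
        using assms(3,4) xyz vert unfolding no_right_angle_def by blast
      then show "(y - x) \<bullet> (z - x) \<noteq> 0"
        by (auto simp: angle_at_def)
      show "cross2 (y - x) (z - x) \<noteq> 0"
        using nc xyz abc(1) by (intro cross2_nonzero) simp
    qed
    have "\<sigma> a = 0" "\<sigma> b = 0" "\<sigma> c = 0"
      using vertex0[of b a c] vertex0[of a b c] vertex0[of a c b] abc by auto
    then show "\<sigma> = 0"
      using P1_S2_eq_0[of \<sigma> C] \<sigma> by (auto simp: C(3) abc(1))
  qed
qed

end
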